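(* We have $$\sum_{n\geq1}c_n(31\text{-}2)t^n=\frac{t}{1-t}+\sum_{i\geq1}\frac{\prod_{j=1}^i\left(1+\frac{U_{j-1}(s)}{U_j(s)}\right)}{U_{i+1}(s)},$$ where $s=\frac{1-t}{2t}$.
   Context: A Catalan word of length $n\ge 1$ is a sequence $\pi=\pi_1\cdots\pi_n$ of positive integers with $\pi_1=1$ and $\pi_{i+1}\le \pi_i+1$ for $1\le i\le n-1$; $\mathcal{C}_n$ is the set of these. Two sequences of the same length are order-isomorphic if their corresponding pairs of entries stand in the same relation ($<$, $>$ or $=$). A word $\pi$ contains the vincular pattern $xy\text{-}z$ if there are indices $i,j$ with $i+1<j\le n$ such that $\pi_i\pi_{i+1}\pi_j$ is order-isomorphic to $xyz$ (the first two letters must be adjacent in $\pi$); otherwise $\pi$ avoids it. $c_n(\tau)$ denotes the number of members of $\mathcal{C}_n$ avoiding $\tau$. $U_n$ is the Chebyshev polynomial of the second kind: $U_0(x)=1$, $U_1(x)=2x$, $U_n(x)=2xU_{n-1}(x)-U_{n-2}(x)$ for $n\ge2$. The identity is one of power series in $t$ (each summand is a rational function of $t$, expanded about $t=0$). *)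

theory Defs
  imports Complex_Main "HOL-Computational_Algebra.Computational_Algebra"
begin

text \<open>Lists are 0-indexed: the letter \<open>\<pi>\<^sub>i\<close> of a word is \<open>\<pi> ! (i - 1)\<close>.\<close>

definition catalan_words :: "nat \<Rightarrow> nat list set" where
  "catalan_words n = {\<pi>. length \<pi> = n \<and> \<pi> \<noteq> [] \<and> (\<forall>a\<in>set \<pi>. a > 0) \<and> \<pi> ! 0 = 1 \<and>
     (\<forall>i. i + 1 < n \<longrightarrow> \<pi> ! (i + 1) \<le> \<pi> ! i + 1)}"

definition order_isomorphic :: "nat list \<Rightarrow> nat list \<Rightarrow> bool" where
  "order_isomorphic u v \<longleftrightarrow> length u = length v \<and>
     (\<forall>i<length u. \<forall>j<length u.
        (u ! i < u ! j \<longleftrightarrow> v ! i < v ! j) \<and>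
        (u ! i > u ! j \<longleftrightarrow> v ! i > v ! j) \<and>
        (u ! i = u ! j \<longleftrightarrow> v ! i = v ! j))"

text \<open>The triple \<open>(x, y, z)\<close> encodes the vincular pattern \<open>xy-z\<close>.\<close>

definition contains_vincular :: "nat list \<Rightarrow> nat \<times> nat \<times> nat \<Rightarrow> bool" where
  "contains_vincular \<pi> \<tau> \<longleftrightarrow> (case \<tau> of (x, y, z) \<Rightarrow>
     \<exists>i j. i + 1 < j \<and> j < length \<pi> \<and> order_isomorphic [\<pi> ! i, \<pi> ! (i + 1), \<pi> ! j] [x, y, z])"

definition catalan_avoid_count :: "nat \<times> nat \<times> nat \<Rightarrow> nat \<Rightarrow> nat" where
  "catalan_avoid_count \<tau> n = card {\<pi> \<in> catalan_words n. \<not> contains_vincular \<pi> \<tau>}"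

fun chebyshev_U :: "nat \<Rightarrow> 'a::comm_ring_1 poly" where
  "chebyshev_U 0 = 1"
| "chebyshev_U (Suc 0) = [:0, 2:]"
| "chebyshev_U (Suc (Suc n)) = [:0, 2:] * chebyshev_U (Suc n) - chebyshev_U n"

end

theory Submission
  imports Defs
begin

text \<open>
  A descent \<open>a b\<close> with \<open>a \<ge> b + 2\<close> forbids every later letter strictly between \<open>b\<close> and \<open>a\<close>. A
  Catalan word rises by at most one at a time, so it cannot get past the forbidden value \<open>b + 1\<close>:
  such a descent caps all later letters at \<open>b\<close>. Conversely a word avoids \<open>31-2\<close> as soon as each of
  these caps is respected, since descents by one forbid nothing. Hence the avoiding words are
  generated one letter at a time by an automaton whose state is the last letter together with the
  current cap (lemma \<open>card_capped_words_Suc\<close>).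

  The solution of the resulting linear system can be read off from the words. Cut a word with
  maximum \<open>m\<close> after its last \<open>m\<close>. The first part is a path with steps \<open>1, 0, -1\<close> from \<open>1\<close> to \<open>m\<close>
  in the strip \<open>{1..m}\<close>; counted by letters, the paths from \<open>a\<close> to \<open>m\<close> have the generating function
  \<open>U\<^bsub>a-1\<^esub>(s) / U\<^bsub>m\<^esub>(s)\<close>. The rest, if any, starts at its own maximum
  \<open>j < m\<close>: its first letter is \<open>m - 1\<close> or is the cap set by the descent. It is cut after its last
  \<open>j\<close> in turn, and so on: each level \<open>j < m\<close> contributes either nothing or a path from \<open>j\<close> to \<open>j\<close> in the strip
  \<open>{1..j}\<close>, that is a factor \<open>1 + U\<^bsub>j-1\<^esub>(s) / U\<^bsub>j\<^esub>(s)\<close>. So the words with maximum \<open>i + 1\<close> are counted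
  by the \<open>i\<close>-th summand, and \<open>t / (1 - t)\<close> is the summand for \<open>i = 0\<close>.

  Instead of making these decompositions into bijections, the proof checks that the predicted
  series satisfy the linear system of the automaton (lemma \<open>predicted_series_eq\<close>). As one letter
  contributes one factor \<open>t\<close>, the system determines all coefficients recursively (lemma
  \<open>predicted_series_nth\<close>). Words of length \<open>n\<close> have letters at most \<open>n\<close>, so the partial sums agree
  with the left-hand side up to degrees that tend to infinity.
\<close>

section \<open>Avoiding words as an automaton\<close>

lemma order_isomorphic_312: "order_isomorphic [p, q, r] [3, 1, 2] \<longleftrightarrow> q < r \<and> r < p"
  by (auto simp: order_isomorphic_def less_Suc_eq All_less_Suc numeral_3_eq_3)

text \<open>A constant of its own, as the simplifier would turn the \<open>1\<close> of the pattern into \<open>Suc 0\<close>.\<close>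

definition contains_312 :: "nat list \<Rightarrow> bool" where
  "contains_312 w \<longleftrightarrow> contains_vincular w (3, 1, 2)"

lemma contains_312_iff:
  "contains_312 w \<longleftrightarrow>
     (\<exists>i j. i + 1 < j \<and> j < length w \<and> w ! (i + 1) < w ! j \<and> w ! j < w ! i)"
  by (simp only: contains_312_def contains_vincular_def order_isomorphic_312 prod.case)

lemma contains_312_single: "\<not> contains_312 [a]"
  by (simp add: contains_312_iff)

lemma contains_312_Cons_Cons:
  "contains_312 (a # b # w) \<longleftrightarrow> (\<exists>z\<in>set w. b < z \<and> z < a) \<or> contains_312 (b # w)"
proof
  assume "contains_312 (a # b # w)"
  then obtain i j where ij: "i + 1 < j" "j < length (a # b # w)"
      "(a # b # w) ! (i + 1) < (a # b # w) ! j" "(a # b # w) ! j < (a # b # w) ! i"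
    unfolding contains_312_iff by blast
  show "(\<exists>z\<in>set w. b < z \<and> z < a) \<or> contains_312 (b # w)"
  proof (cases i)
    case 0
    with ij(1) obtain j' where "j = Suc (Suc j')"
      by (metis Suc_eq_plus1 add_0 less_imp_Suc_add add_Suc)
    with ij 0 have "w ! j' \<in> set w" "b < w ! j'" "w ! j' < a" by auto
    then show ?thesis by blast
  next
    case (Suc i')
    with ij(1) obtain j' where j': "j = Suc j'"
      by (cases j) auto
    have "i' + 1 < j' \<and> j' < length (b # w) \<and> (b # w) ! (i' + 1) < (b # w) ! j' \<and>
        (b # w) ! j' < (b # w) ! i'"
      using ij by (simp add: Suc j')
    then show ?thesis unfolding contains_312_iff by blast
  qed
next
  assume "(\<exists>z\<in>set w. b < z \<and> z < a) \<or> contains_312 (b # w)"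
  then show "contains_312 (a # b # w)"
  proof
    assume "\<exists>z\<in>set w. b < z \<and> z < a"
    then obtain j where "j < length w" "b < w ! j" "w ! j < a"
      by (auto simp: in_set_conv_nth)
    then show ?thesis
      unfolding contains_312_iff by (intro exI[of _ 0] exI[of _ "Suc (Suc j)"]) simp
  next
    assume "contains_312 (b # w)"
    then obtain i j where "i + 1 < j" "j < length (b # w)"
        "(b # w) ! (i + 1) < (b # w) ! j" "(b # w) ! j < (b # w) ! i"
      unfolding contains_312_iff by blast
    then show ?thesis
      unfolding contains_312_iff by (intro exI[of _ "Suc i"] exI[of _ "Suc j"]) simp
  qed
qed

definition climbs_slowly :: "nat list \<Rightarrow> bool" where
  "climbs_slowly = successively (\<lambda>x y. y \<le> x + 1)"

lemma climbs_slowly_simps [simp]: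
  "climbs_slowly []" "climbs_slowly [a]"
  "climbs_slowly (a # b # w) \<longleftrightarrow> b \<le> a + 1 \<and> climbs_slowly (b # w)"
  by (simp_all add: climbs_slowly_def)

lemma climbs_slowly_iff_nth:
  "climbs_slowly w \<longleftrightarrow> (\<forall>i. i + 1 < length w \<longrightarrow> w ! (i + 1) \<le> w ! i + 1)"
  by (simp add: climbs_slowly_def successively_conv_nth)

lemma climbs_slowly_bound:
  "climbs_slowly (a # w) \<Longrightarrow> z \<in> set w \<Longrightarrow> z \<le> a + length w"
proof (induction w arbitrary: a)
  case (Cons b w)
  then show ?case by (cases "z = b") (auto dest!: Cons.IH)
qed simp

text \<open>A slowly climbing word that exceeds \<open>d\<close> has to pass through \<open>d + 1\<close> first. The first letter \<open>b\<close>
  is kept apart from the floor \<open>d\<close> of the gap, because it changes along the induction.\<close>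

lemma climbs_slowly_gap:
  assumes "climbs_slowly (b # w)" "b \<le> d" "\<forall>z\<in>set w. \<not> (d < z \<and> z < a)" "d + 2 \<le> a"
  shows "\<forall>z\<in>set w. z \<le> d"
  using assms
proof (induction w arbitrary: b)
  case (Cons x w)
  from Cons.prems have "x \<le> d" by auto
  with Cons.prems Cons.IH[of x] show ?case by auto
qed simp

text \<open>The possible continuations, of length \<open>n\<close> and with letters at most \<open>c\<close>, of an avoiding word
  that ends in \<open>a\<close> and whose earlier descents are accounted for by the cap \<open>c\<close>.\<close>

definition capped_words :: "nat \<Rightarrow> nat \<Rightarrow> nat \<Rightarrow> nat list set" where
  "capped_words c a n = {w. length w = n \<and> set w \<subseteq> {1..c} \<and> climbs_slowly (a # w) \<and>
     \<not> contains_312 (a # w)}"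

lemma finite_capped_words: "finite (capped_words c a n)"
  by (rule finite_subset[OF _ finite_lists_length_eq[of "{1..c}" n]])
     (auto simp: capped_words_def)

lemma capped_words_0: "capped_words c a 0 = {[]}"
  by (auto simp: capped_words_def contains_312_single)

text \<open>A descent by at least two replaces the cap by its lower letter. The old cap is then implied, as
  it is at least \<open>a\<close>.\<close>

lemma Cons_in_capped_words_iff:
  assumes "a \<le> c"
  shows "b # w \<in> capped_words c a (Suc n) \<longleftrightarrow>
    b \<in> {1..min c (a + 1)} \<and> w \<in> capped_words (if a \<le> b + 1 then c else b) b n"
proof (cases "a \<le> b + 1")
  case True
  then have "\<not> (\<exists>z\<in>set w. b < z \<and> z < a)" by auto
  with True show ?thesis
    by (auto simp: capped_words_def contains_312_Cons_Cons)
next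
  case False
  then have "b + 2 \<le> a" by simp
  have gap: "(\<forall>z\<in>set w. \<not> (b < z \<and> z < a)) \<longleftrightarrow> (\<forall>z\<in>set w. z \<le> b)"
    if "climbs_slowly (b # w)"
    using climbs_slowly_gap[OF that order_refl _ \<open>b + 2 \<le> a\<close>] by force
  from False assms show ?thesis
    using gap by (fastforce simp: capped_words_def contains_312_Cons_Cons)
qed

lemma card_capped_words_Suc:
  assumes "a \<le> c"
  shows "card (capped_words c a (Suc n)) =
    (\<Sum>b\<in>{1..min c (a + 1)}. card (capped_words (if a \<le> b + 1 then c else b) b n))"
proof -
  let ?W = "\<lambda>b. capped_words (if a \<le> b + 1 then c else b) b n"
  have "capped_words c a (Suc n) = (\<Union>b\<in>{1..min c (a + 1)}. (#) b ` ?W b)"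
  proof (intro set_eqI)
    fix v
    show "v \<in> capped_words c a (Suc n) \<longleftrightarrow> v \<in> (\<Union>b\<in>{1..min c (a + 1)}. (#) b ` ?W b)"
    proof (cases v)
      case Nil
      then show ?thesis by (auto simp: capped_words_def)
    next
      case (Cons b w)
      then show ?thesis
        using Cons_in_capped_words_iff[OF assms, of b w n] by (auto split: if_splits)
    qed
  qed
  also have "card \<dots> = (\<Sum>b\<in>{1..min c (a + 1)}. card ((#) b ` ?W b))"
    by (rule card_UN_disjoint) (auto simp: finite_capped_words)
  also have "\<dots> = (\<Sum>b\<in>{1..min c (a + 1)}. card (?W b))"
    by (simp add: card_image)
  finally show ?thesis .
qed

text \<open>Letters exceed the first one by less than the length, so a cap that is at least the length
  restricts nothing.\<close>

lemma catalan_avoid_count_eq_card_capped: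
  assumes "Suc n \<le> c"
  shows "catalan_avoid_count (3, 1, 2) (Suc n) = card (capped_words c 1 n)"
proof -
  have "{\<pi> \<in> catalan_words (Suc n). \<not> contains_312 \<pi>} = (#) 1 ` capped_words c 1 n"
    (is "?A = ?B")
  proof
    show "?A \<subseteq> ?B"
    proof
      fix \<pi> assume \<pi>: "\<pi> \<in> ?A"
      then obtain w where w: "\<pi> = 1 # w" "length w = n"
        by (cases \<pi>) (auto simp: catalan_words_def)
      with \<pi> have "climbs_slowly (1 # w)" "\<forall>z\<in>set w. z > 0"
        by (auto simp: catalan_words_def climbs_slowly_iff_nth)
      with climbs_slowly_bound[of 1 w] assms w(2) have "set w \<subseteq> {1..c}"
        by fastforce
      with \<pi> w \<open>climbs_slowly (1 # w)\<close> show "\<pi> \<in> ?B"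
        by (auto simp: capped_words_def)
    qed
    show "?B \<subseteq> ?A"
      by (fastforce simp: capped_words_def catalan_words_def climbs_slowly_iff_nth)
  qed
  then show ?thesis
    unfolding catalan_avoid_count_def contains_312_def by (simp add: card_image)
qed

section \<open>The Chebyshev values as Laurent series\<close>

unbundle fps_syntax

definition cheb :: "nat \<Rightarrow> rat fls" where
  "cheb n = poly (chebyshev_U n) ((1 - fls_X) / (2 * fls_X))"

lemma cheb_0: "cheb 0 = 1"
  and cheb_1: "cheb (Suc 0) = (1 - fls_X) / fls_X"
  and cheb_rec: "cheb (Suc (Suc n)) = (1 - fls_X) / fls_X * cheb (Suc n) - cheb n"
  by (simp_all add: cheb_def field_simps del: fls_divide_X)

text \<open>The two relations say that in the strip a letter is followed by itself or a neighbour, where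
  the lowest level has no neighbour below.\<close>

lemma cheb_strip:
  "fls_X * (cheb 0 + cheb (Suc 0)) = cheb 0"
  "fls_X * (cheb n + cheb (Suc n) + cheb (Suc (Suc n))) = cheb (Suc n)"
  by (simp_all add: cheb_rec cheb_1 cheb_0 field_simps del: fls_divide_X)

lemma cheb_nonzero_subdegree: "cheb n \<noteq> 0 \<and> fls_subdegree (cheb n) = - int n"
proof (induction n rule: chebyshev_U.induct)
  case 1
  then show ?case by (simp add: cheb_0)
next
  have one_minus_X: "(1 :: rat fls) - fls_X \<noteq> 0" "fls_subdegree (1 - fls_X :: rat fls) = 0"
    by (simp_all add: fls_subdegree_diff_eq1 fls_eq_iff) (metis fls_X_nth one_neq_zero fls_one_nth)
  then have two_s: "(1 - fls_X) / fls_X \<noteq> (0 :: rat fls)"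
      "fls_subdegree ((1 - fls_X) / fls_X :: rat fls) = -1"
    by (simp_all add: fls_divide_subdegree del: fls_divide_X)
  {
    case 2
    show ?case using two_s by (simp add: cheb_1 del: fls_divide_X)
  next
    case (3 n)
    let ?f = "(1 - fls_X) / fls_X * cheb (Suc n)"
    have f: "?f \<noteq> 0" "fls_subdegree ?f = - int (Suc (Suc n))"
      using 3 two_s by (simp_all del: times_divide_eq_left fls_divide_X)
    then have "fls_subdegree (?f - cheb n) = - int (Suc (Suc n))"
      using 3 by (subst fls_subdegree_diff_eq1) auto
    then show ?case by (auto simp: cheb_rec simp del: times_divide_eq_left fls_divide_X)
  }
qed

lemma cheb_nonzero [simp]: "cheb n \<noteq> 0"
  and cheb_subdegree [simp]: "fls_subdegree (cheb n) = - int n"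
  using cheb_nonzero_subdegree by auto

section \<open>The predicted generating functions\<close>

text \<open>The series for the part of a word after the last occurrence of its maximum \<open>i + 1\<close>.\<close>

definition tail_series :: "nat \<Rightarrow> rat fls" where
  "tail_series i = (\<Prod>j=1..i. 1 + cheb (j - 1) / cheb j)"

text \<open>The series for words that start with the letter \<open>k + 1\<close> (counted in the length) and have
  letters at most \<open>c\<close>; the summand \<open>m\<close> is for the words with maximum \<open>m + 1\<close>.\<close>

definition predicted_series :: "nat \<Rightarrow> nat \<Rightarrow> rat fls" where
  "predicted_series c k = cheb k * (\<Sum>m\<in>{k..<c}. tail_series m / cheb (Suc m))"

lemma tail_series_0 [simp]: "tail_series 0 = 1"
  and tail_series_Suc: "tail_series (Suc i) = tail_series i * (1 + cheb i / cheb (Suc i))"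
  by (simp_all add: tail_series_def)

lemma tail_series_subdegree: "tail_series i \<noteq> 0 \<and> fls_subdegree (tail_series i) = 0"
proof (induction i)
  case (Suc i)
  have "fls_subdegree (cheb i / cheb (Suc i)) = 1"
    by (simp add: fls_divide_subdegree)
  then have "fls_subdegree (1 + cheb i / cheb (Suc i)) = 0"
    by (subst fls_subdegree_add_eq1) auto
  moreover have "1 + cheb i / cheb (Suc i) \<noteq> 0"
    using \<open>fls_subdegree (cheb i / cheb (Suc i)) = 1\<close>
    by (metis add_eq_0_iff fls_one_subdegree fls_uminus_subdegree zero_neq_one)
  ultimately show ?case
    using Suc by (simp add: tail_series_Suc)
qed simp

text \<open>The summand \<open>m\<close> has order \<open>m + 1 - k\<close>, the least number of letters needed to climb from
  \<open>k + 1\<close> to \<open>m + 1\<close>.\<close>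

lemma predicted_series_nth_nonpos:
  assumes "j \<le> 0"
  shows "predicted_series c k $$ j = 0"
proof -
  have "(cheb k * (tail_series m / cheb (Suc m))) $$ j = 0" if "k \<le> m" for m
  proof (rule fls_eq0_below_subdegree)
    show "j < fls_subdegree (cheb k * (tail_series m / cheb (Suc m)))"
      using tail_series_subdegree[of m] assms that
      by (simp add: fls_divide_subdegree del: times_divide_eq_right)
  qed
  then show ?thesis
    by (simp add: predicted_series_def sum_distrib_left fls_nth_sum del: times_divide_eq_right)
qed

text \<open>A word starting with its maximum \<open>l + 1\<close> is exactly what the factor for level \<open>l + 1\<close> adds.\<close>

lemma predicted_series_start_at_cap:
  "predicted_series (Suc l) l = tail_series (Suc l) - tail_series l"
  by (simp add: predicted_series_def tail_series_Suc algebra_simps)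

lemma predicted_series_empty: "c \<le> k \<Longrightarrow> predicted_series c k = 0"
  by (simp add: predicted_series_def)

text \<open>The neighbouring levels combine by the strip relation, up to boundary terms from the three
  different ranges of summation. These cancel against the words that start with a larger descent,
  whose series telescope.\<close>

lemma predicted_series_eq:
  assumes "k < c"
  shows "predicted_series c k = fls_X * (1 + (\<Sum>l<min c (k + 2).
    predicted_series (if k \<le> l + 1 then c else l + 1) l))"
proof (cases k)
  case 0
  define T where "T = (\<Sum>m\<in>{0..<c}. tail_series m / cheb (Suc m))"
  have T: "T = 1 / cheb 1 + (\<Sum>m\<in>{Suc 0..<c}. tail_series m / cheb (Suc m))"
    using assms unfolding T_def by (simp add: 0 sum.atLeast_Suc_lessThan)
  have "(\<Sum>l<min c (k + 2). predicted_series (if k \<le> l + 1 then c else l + 1) l) =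
      (\<Sum>l<2. predicted_series c l)"
    unfolding 0 using assms 0
    by (intro sum.mono_neutral_cong_left)
       (auto simp: predicted_series_empty min_def less_Suc_eq numeral_2_eq_2 split: if_splits)
  also have "\<dots> = cheb 0 * T + cheb 1 * (T - 1 / cheb 1)"
    by (simp add: numeral_2_eq_2 predicted_series_def T T_def[symmetric])
  finally have "1 + (\<Sum>l<min c (k + 2). predicted_series (if k \<le> l + 1 then c else l + 1) l) =
      (cheb 0 + cheb (Suc 0)) * T"
    by (simp add: cheb_0 algebra_simps)
  moreover have "predicted_series c k = cheb 0 * T"
    by (simp add: predicted_series_def T_def 0)
  ultimately show ?thesis
    using cheb_strip(1) by (simp flip: mult.assoc)
next
  case (Suc p)
  define R where "R m = tail_series m / cheb (Suc m)" for m
  define T where "T = (\<Sum>m\<in>{Suc p..<c}. R m)"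
  have T0: "(\<Sum>m\<in>{p..<c}. R m) = R p + T"
    using assms unfolding T_def by (simp add: Suc sum.atLeast_Suc_lessThan)
  have T2: "(\<Sum>m\<in>{Suc (Suc p)..<c}. R m) = T - R (Suc p)"
    using assms unfolding T_def by (simp add: Suc sum.atLeast_Suc_lessThan)
  have boundary: "cheb (Suc (Suc p)) * R (Suc p) = tail_series p + cheb p * R p"
    by (simp add: R_def tail_series_Suc field_simps)
  let ?h = "\<lambda>l. predicted_series (if k \<le> l + 1 then c else l + 1) l"
  \<comment> \<open>The upper neighbour may lie above the cap; its series is then an empty sum.\<close>
  have "(\<Sum>l<min c (k + 2). ?h l) = (\<Sum>l<Suc (Suc (Suc p)). ?h l)"
    using assms Suc
    by (intro sum.mono_neutral_cong_left)
       (auto simp: predicted_series_empty min_def less_Suc_eq split: if_splits)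
  also have "\<dots> = (\<Sum>l<p. ?h l) + predicted_series c p + predicted_series c (Suc p) +
      predicted_series c (Suc (Suc p))"
    by (simp add: Suc)
  also have "(\<Sum>l<p. ?h l) = (\<Sum>l<p. tail_series (Suc l) - tail_series l)"
    by (intro sum.cong) (auto simp: Suc predicted_series_start_at_cap)
  also have "\<dots> = tail_series p - 1"
    by (simp add: sum_lessThan_telescope)
  also have "predicted_series c p = cheb p * (R p + T)"
    by (simp add: predicted_series_def R_def[symmetric] T0)
  also have "predicted_series c (Suc p) = cheb (Suc p) * T"
    by (simp add: predicted_series_def R_def[symmetric] T_def)
  also have "predicted_series c (Suc (Suc p)) =
      cheb (Suc (Suc p)) * T - (tail_series p + cheb p * R p)"
    using boundary by (simp add: predicted_series_def R_def[symmetric] T2 right_diff_distrib)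
  finally have "1 + (\<Sum>l<min c (k + 2). ?h l) = (cheb p + cheb (Suc p) + cheb (Suc (Suc p))) * T"
    by (simp add: algebra_simps)
  moreover have "predicted_series c k = cheb (Suc p) * T"
    by (simp add: predicted_series_def R_def[symmetric] T_def Suc)
  ultimately show ?thesis
    using cheb_strip(2)[of p] by (simp flip: mult.assoc)
qed

text \<open>The factor \<open>t\<close> in the linear system lowers the index by one, which makes it the recurrence for
  the number of words. The first letter is not part of the counted continuation; this is the shift
  by one.\<close>

lemma predicted_series_nth:
  assumes "k < c"
  shows "predicted_series c k $$ (int n + 1) = of_nat (card (capped_words c (Suc k) n))"
  using assms
proof (induction n arbitrary: c k)
  case 0
  have "predicted_series c k $$ 1 = 1"
    by (subst predicted_series_eq[OF 0])
       (simp add: fls_X_times_conv_shift fls_nth_sum predicted_series_nth_nonpos)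
  then show ?case by (simp add: capped_words_0)
next
  case (Suc n)
  let ?c = "\<lambda>l. if k \<le> l + 1 then c else l + 1"
  have "predicted_series c k $$ (int (Suc n) + 1) =
      (\<Sum>l<min c (k + 2). predicted_series (?c l) l $$ (int n + 1))"
    by (subst predicted_series_eq[OF Suc.prems])
       (simp add: fls_X_times_conv_shift fls_nth_sum add.commute)
  also have "\<dots> = (\<Sum>l<min c (k + 2). of_nat (card (capped_words (?c l) (Suc l) n)))"
    by (intro sum.cong refl Suc.IH) auto
  also have "\<dots> = (\<Sum>b\<in>{1..min c (Suc k + 1)}.
      of_nat (card (capped_words (if Suc k \<le> b + 1 then c else b) b n)))"
    by (rule sum.reindex_bij_witness[of _ "\<lambda>b. b - 1" Suc]) auto
  also have "\<dots> = of_nat (card (capped_words c (Suc k) (Suc n)))"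
    using Suc.prems by (simp add: card_capped_words_Suc)
  finally show ?case .
qed

section \<open>Summation\<close>

text \<open>In the metric on Laurent series, agreement of all coefficients up to \<open>n\<close> means distance less
  than \<open>2\<^sup>-\<^sup>n\<close>.\<close>

lemma LIMSEQ_fls_coeffwiseI:
  fixes f :: "nat \<Rightarrow> 'a::group_add fls"
  assumes "\<And>n j. j \<le> int n \<Longrightarrow> f n $$ j = L $$ j"
  shows "f \<longlonglongrightarrow> L"
proof -
  have bound: "dist (f n) L \<le> (1 / 2) ^ n" for n
  proof (cases "f n = L")
    case False
    then have "int n < fls_subdegree (f n - L)"
      using assms by (intro fls_subdegree_greaterI) auto
    then have "dist (f n) L = (1 / 2) ^ nat (fls_subdegree (f n - L))"
      using False by (simp add: dist_fls_def power_one_over inverse_eq_divide)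
    also have "\<dots> \<le> (1 / 2) ^ n"
      using \<open>int n < _\<close> by (intro power_decreasing) auto
    finally show ?thesis .
  qed simp
  have "(\<lambda>n. (1 / 2 :: real) ^ n) \<longlonglongrightarrow> 0"
    by (rule LIMSEQ_realpow_zero) simp_all
  then show ?thesis
    by (rule metric_tendsto_imp_tendsto) (simp add: bound dist_real_def)
qed

theorem theorem3p4:
  fixes t s :: "rat fls" and U :: "nat \<Rightarrow> rat fls" and S :: "nat \<Rightarrow> rat fls"
  defines "t \<equiv> fls_X"
  defines "s \<equiv> (1 - t) / (2 * t)"
  defines "U \<equiv> \<lambda>n. poly (chebyshev_U n) s"
  defines "S \<equiv> \<lambda>i. (\<Prod>j=1..i. 1 + U (j - 1) / U j) / U (i + 1)"
  shows "summable (\<lambda>i. S (i + 1)) \<and>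
    fps_to_fls (Abs_fps (\<lambda>n. if n \<ge> 1 then of_nat (catalan_avoid_count (3, 1, 2) n) else 0)) =
      t / (1 - t) + (\<Sum>i. S (i + 1))"
proof -
  define F :: "rat fls" where "F = fps_to_fls (Abs_fps
    (\<lambda>n. if n \<ge> 1 then of_nat (catalan_avoid_count (3, 1, 2) n) else 0))"
  have U: "U = cheb"
    by (simp add: U_def s_def t_def cheb_def fun_eq_iff)
  have S: "S i = tail_series i / cheb (Suc i)" for i
    by (simp add: S_def U tail_series_def)
  have F_nth: "predicted_series c 0 $$ j = F $$ j" if "j \<le> int c" for j c
  proof (cases "j \<le> 0")
    case True
    then show ?thesis by (simp add: F_def predicted_series_nth_nonpos)
  next
    case False
    then obtain n where n: "j = int n + 1"
      by (metis add.commute not_le zle_iff_zadd zless_imp_add1_zle add_0)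
    with that have "Suc n \<le> c" by simp
    then have "predicted_series c 0 $$ j = of_nat (catalan_avoid_count (3, 1, 2) (Suc n))"
      unfolding n
      using catalan_avoid_count_eq_card_capped[of n c] by (subst predicted_series_nth) simp_all
    then show ?thesis by (simp add: F_def n nat_add_distrib)
  qed
  have partial: "(\<Sum>i<n. S (i + 1)) = predicted_series (Suc n) 0 - t / (1 - t)" for n
  proof -
    have "predicted_series (Suc n) 0 = (\<Sum>i<Suc n. S i)"
      by (simp add: predicted_series_def S cheb_0 atLeast0LessThan)
    also have "\<dots> = S 0 + (\<Sum>i<n. S (i + 1))"
      by (simp add: sum.lessThan_Suc_shift del: sum.lessThan_Suc)
    also have "S 0 = t / (1 - t)"
      by (simp add: S cheb_1 t_def del: fls_divide_X)
    finally show ?thesis by simp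
  qed
  have "(\<lambda>i. S (i + 1)) sums (F - t / (1 - t))"
    unfolding sums_def partial by (rule LIMSEQ_fls_coeffwiseI) (simp add: F_nth)
  then show ?thesis
    unfolding F_def[symmetric] by (auto simp: sums_iff)
qed

end
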